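(* For every $\alpha\in\mathbb R^{G\times D}$ (with $d$th column $\alpha_d\in\mathbb R^G$) and every $\beta_{1:M}=(\beta_1,\ldots,\beta_M)$ with $\beta_j\in\mathbb R^G$, the worst-case total generation cost $f_\Omega(\hat x_{\alpha,\beta_{1:M}})=\sup_{\xi\in\Omega}\int_{\mathcal T}C^\top\hat x_{\alpha,\beta_{1:M}}(\xi,t)\,dt$ satisfies $$f_\Omega\left(\hat x_{\alpha,\beta_{1:M}}\right)=\frac12\sum_{j=1}^{M-1}\Delta^{\rm b}_jC^\top(\beta_{j+1}+\beta_j)+\frac12\sum_{d=1}^D\sup\left\{\sum_{j=1}^{M-1}\Delta^{\rm b}_j\,\overline\omega^{\rm s}_{d,j}\,C^\top\alpha_d,\ \sum_{j=1}^{M-1}\Delta^{\rm b}_j\,\underline\omega^{\rm s}_{d,j}\,C^\top\alpha_d\right\},$$ where $\overline\omega^{\rm s}_{d,j}:=\overline\omega_d(T^{\rm b}_{j+1})+\overline\omega_d(T^{\rm b}_j)$ and $\underline\omega^{\rm s}_{d,j}:=\underline\omega_d(T^{\rm b}_{j+1})+\underline\omega_d(T^{\rm b}_j)$.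
   Context: Notation: $\mathbb N[n]:=\{1,\ldots,n\}$; $G,D$ are positive integers (numbers of generators and loads); $T\in(0,\infty)$, $\mathcal T:=[0,T]$; $\mathcal C_n$ is the set of continuous functions $\mathcal T\to\mathbb R^n$; $\mathcal T^{\rm o}:=\{(t_1,t_2)\in\mathcal T^2:t_1<t_2\}$. $C\in\mathbb R^G_+$ is a cost coefficient vector. Demand data: for each $d\in\mathbb N[D]$, $\Xi_d$ is a given set, with at least two elements, of functions $\xi_d:\mathcal T\to\mathbb R$. With $R(\xi_d,t_1,t_2):=(\xi_d(t_2)-\xi_d(t_1))/(t_2-t_1)$, it is assumed that $\overline r_d:=\sup\{R(\xi_d,t_1,t_2):\xi_d\in\Xi_d,(t_1,t_2)\in\mathcal T^{\rm o}\}<\infty$ and $\underline r_d:=\inf\{R(\xi_d,t_1,t_2):\xi_d\in\Xi_d,(t_1,t_2)\in\mathcal T^{\rm o}\}>-\infty$. Superset $\Omega$: fix an integer $N\ge2$ and equally spaced points $0=T_1<T_2<\cdots<T_N=T$. Let $i(t):=j$ if $t\in[T_j,T_{j+1})$ and $i(T):=N-1$. Let $\overline\omega'_d(t):=\sup\{\xi_d(\tau):\xi_d\in\Xi_d,\tau\in[T_{i(t)},T_{i(t)+1}]\}$ and $\underline\omega'_d(t):=\inf\{\xi_d(\tau):\xi_d\in\Xi_d,\tau\in[T_{i(t)},T_{i(t)+1}]\}$, assumed finite. Let $$\Omega_d:=\{\xi_d\in\mathcal C_1:\underline\omega'_d(t)\le\xi_d(t)\le\overline\omega'_d(t)\ \forall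 t\in\mathcal T,\ \underline r_d\le R(\xi_d,t_1,t_2)\le\overline r_d\ \forall(t_1,t_2)\in\mathcal T^{\rm o}\},\quad \Omega:=\Omega_1\times\cdots\times\Omega_D\subset\mathcal C_D.$$ Envelopes $\overline\omega_d,\underline\omega_d\in\mathcal C_1$: each is the continuous piecewise affine function determined by its breakpoints and its values there (convention $0/0=0$). For $j\in\mathbb N[N-2]$ let $\overline\omega'^{+}_{d,j}:=\overline\omega'_d(T_{j+1})-\overline\omega'_d(T_j)$ and $\underline\omega'^{+}_{d,j}:=\underline\omega'_d(T_{j+1})-\underline\omega'_d(T_j)$. Breakpoints of $\overline\omega_d$: $\overline{\mathcal T}^{\rm b}_d:=\{T_1,\ldots,T_N\}\cup\{\overline T^{\rm b}_{d,1},\ldots,\overline T^{\rm b}_{d,N-2}\}$, where $\overline T^{\rm b}_{d,j}:=T_{j+1}+\overline\omega'^{+}_{d,j}/\overline r_d$ if $\overline\omega'^{+}_{d,j}\ge0$, and $T_{j+1}-\overline\omega'^{+}_{d,j}/\underline r_d$ otherwise. Values: $\overline\omega_d(T_1):=\overline\omega'_d(T_1)$; $\overline\omega_d(T_{j+1}):=\min\{\overline\omega'_d(T_j),\overline\omega'_d(T_{j+1})\}$ for $j\in\mathbb N[N-1]$; $\overline\omega_d(\overline T^{\rm b}_{d,j}):=\max\{\overline\omega'_d(T_j),\overline\omega'_d(T_{j+1})\}$ for $j\in\mathbb N[N-2]$. Breakpoints of $\underline\omega_d$: $\underline{\mathcal T}^{\rm b}_d:=\{T_1,\ldots,T_N\}\cup\{\underline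 T^{\rm b}_{d,1},\ldots,\underline T^{\rm b}_{d,N-2}\}$, where $\underline T^{\rm b}_{d,j}:=T_{j+1}-\underline\omega'^{+}_{d,j}/\overline r_d$ if $\underline\omega'^{+}_{d,j}\ge0$, and $T_{j+1}+\underline\omega'^{+}_{d,j}/\underline r_d$ otherwise. Values: $\underline\omega_d(T_1):=\underline\omega'_d(T_1)$; $\underline\omega_d(T_{j+1}):=\max\{\underline\omega'_d(T_j),\underline\omega'_d(T_{j+1})\}$ for $j\in\mathbb N[N-1]$; $\underline\omega_d(\underline T^{\rm b}_{d,j}):=\min\{\underline\omega'_d(T_j),\underline\omega'_d(T_{j+1})\}$ for $j\in\mathbb N[N-2]$. Standing property of the setting: $\overline\omega_d$ and $\underline\omega_d$ belong to $\Omega_d$ and are its pointwise largest and smallest elements, and $\{\xi_d(t):\xi_d\in\Omega_d\}=[\underline\omega_d(t),\overline\omega_d(t)]$ for all $t\in\mathcal T$. Decision rule: let $\mathcal T^{\rm b}:=\bigcup_{d\in\mathbb N[D]}(\overline{\mathcal T}^{\rm b}_d\cup\underline{\mathcal T}^{\rm b}_d)=\{T^{\rm b}_1,\ldots,T^{\rm b}_M\}$ with $0=T^{\rm b}_1<\cdots<T^{\rm b}_M=T$, $M=|\mathcal T^{\rm b}|$, and $\Delta^{\rm b}_j:=T^{\rm b}_{j+1}-T^{\rm b}_j$. Let $k(t):=j$ if $t\in[T^{\rm b}_j,T^{\rm b}_{j+1})$, $k(T):=M-1$; $\gamma(t):=(t-T^{\rm b}_{k(t)})/\Delta^{\rm b}_{k(t)}$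 for $t\in[0,T)$, $\gamma(T):=1$. For $\alpha\in\mathbb R^{G\times D}$ and $\beta_1,\ldots,\beta_M\in\mathbb R^G$, and $\xi\in\Omega$, $t\in\mathcal T$, $$\hat x_{\alpha,\beta_{1:M}}(\xi,t):=\alpha\xi(t)+(1-\gamma(t))\beta_{k(t)}+\gamma(t)\beta_{k(t)+1}\in\mathbb R^G.$$ *)

theory Defs
  imports "HOL-Analysis.Analysis"
begin

text \<open>
  Throughout, \<open>T\<close> is the horizon, \<open>N\<close> the number of equally spaced grid points, and
  \<open>X\<close> the set of demand trajectories of a single load.  Trajectories are functions on the time
  interval \<open>{0..T}\<close>; they are represented by functions \<open>real \<Rightarrow> real\<close> of which only
  the values on \<open>{0..T}\<close> matter.  Indices \<open>j\<close> of grid points and breakpoints start at 1.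
\<close>

definition ordered_pairs :: "real \<Rightarrow> (real \<times> real) set" where
  "ordered_pairs T = {(t1, t2). t1 \<in> {0..T} \<and> t2 \<in> {0..T} \<and> t1 < t2}"

definition rate :: "(real \<Rightarrow> real) \<Rightarrow> real \<Rightarrow> real \<Rightarrow> real" where
  "rate \<xi> t1 t2 = (\<xi> t2 - \<xi> t1) / (t2 - t1)"

definition rates :: "real \<Rightarrow> (real \<Rightarrow> real) set \<Rightarrow> real set" where
  "rates T X = {rate \<xi> t1 t2 | \<xi> t1 t2. \<xi> \<in> X \<and> (t1, t2) \<in> ordered_pairs T}"

definition r_upper :: "real \<Rightarrow> (real \<Rightarrow> real) set \<Rightarrow> real" where
  "r_upper T X = Sup (rates T X)"

definition r_lower :: "real \<Rightarrow> (real \<Rightarrow> real) set \<Rightarrow> real" where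
  "r_lower T X = Inf (rates T X)"

definition grid :: "real \<Rightarrow> nat \<Rightarrow> nat \<Rightarrow> real" where
  "grid T N j = T * (real j - 1) / (real N - 1)"

definition grid_index :: "real \<Rightarrow> nat \<Rightarrow> real \<Rightarrow> nat" where
  "grid_index T N t =
     (if t = T then N - 1
      else (THE j. j \<in> {1..N-1} \<and> t \<in> {grid T N j..<grid T N (j+1)}))"

definition cell_values :: "real \<Rightarrow> nat \<Rightarrow> (real \<Rightarrow> real) set \<Rightarrow> real \<Rightarrow> real set" where
  "cell_values T N X t =
     {\<xi> \<tau> | \<xi> \<tau>. \<xi> \<in> X \<and>
        \<tau> \<in> {grid T N (grid_index T N t)..grid T N (grid_index T N t + 1)}}"

definition step_upper :: "real \<Rightarrow> nat \<Rightarrow> (real \<Rightarrow> real) set \<Rightarrow> real \<Rightarrow> real" where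
  "step_upper T N X t = Sup (cell_values T N X t)"

definition step_lower :: "real \<Rightarrow> nat \<Rightarrow> (real \<Rightarrow> real) set \<Rightarrow> real \<Rightarrow> real" where
  "step_lower T N X t = Inf (cell_values T N X t)"

definition Omega1 :: "real \<Rightarrow> nat \<Rightarrow> (real \<Rightarrow> real) set \<Rightarrow> (real \<Rightarrow> real) set" where
  "Omega1 T N X =
     {\<xi>. continuous_on {0..T} \<xi> \<and>
          (\<forall>t\<in>{0..T}. step_lower T N X t \<le> \<xi> t \<and> \<xi> t \<le> step_upper T N X t) \<and>
          (\<forall>(t1, t2)\<in>ordered_pairs T.
             r_lower T X \<le> rate \<xi> t1 t2 \<and> rate \<xi> t1 t2 \<le> r_upper T X)}"

definition Omega :: "real \<Rightarrow> nat \<Rightarrow> ('d \<Rightarrow> (real \<Rightarrow> real) set) \<Rightarrow> (real \<Rightarrow> real^'d) set" where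
  "Omega T N \<Xi> = {\<xi>. \<forall>d. (\<lambda>t. \<xi> t $ d) \<in> Omega1 T N (\<Xi> d)}"

text \<open>
  The continuous piecewise affine function through a finite set \<open>P\<close> of nodes
  (breakpoint, value).  At a breakpoint the two neighbours \<open>a\<close> and \<open>c\<close> coincide, and
  \<open>x / 0 = 0\<close> leaves the prescribed value.
\<close>

definition pw_affine :: "(real \<times> real) set \<Rightarrow> real \<Rightarrow> real" where
  "pw_affine P t =
     (let v = (\<lambda>b. THE y. (b, y) \<in> P);
          a = Max {b \<in> fst ` P. b \<le> t};
          c = Min {b \<in> fst ` P. t \<le> b}
      in v a + (t - a) / (c - a) * (v c - v a))"

lemma pw_affine_node:
  assumes "finite P" "(b, y) \<in> P" "\<And>y'. (b, y') \<in> P \<Longrightarrow> y' = y"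
  shows "pw_affine P b = y"
proof -
  have "b \<in> fst ` P" using assms(2) by force
  then have "Max {x \<in> fst ` P. x \<le> b} = b" "Min {x \<in> fst ` P. b \<le> x} = b"
    using assms(1) by (auto intro!: Max_eqI Min_eqI)
  moreover have "(THE y'. (b, y') \<in> P) = y" using assms(2,3) by blast
  ultimately show ?thesis by (simp add: pw_affine_def)
qed

text \<open>
  The convention \<open>0 / 0 = 0\<close> is used below when \<open>\<delta> = 0\<close> and the rate bound is zero.
\<close>

definition upper_break :: "real \<Rightarrow> nat \<Rightarrow> (real \<Rightarrow> real) set \<Rightarrow> nat \<Rightarrow> real" where
  "upper_break T N X j =
     (let \<delta> = step_upper T N X (grid T N (j+1)) - step_upper T N X (grid T N j)
      in if \<delta> \<ge> 0 then grid T N (j+1) + \<delta> / r_upper T X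
         else grid T N (j+1) - \<delta> / r_lower T X)"

definition upper_nodes :: "real \<Rightarrow> nat \<Rightarrow> (real \<Rightarrow> real) set \<Rightarrow> (real \<times> real) set" where
  "upper_nodes T N X =
     (let w = (\<lambda>j. step_upper T N X (grid T N j))
      in {(grid T N 1, w 1)}
         \<union> (\<lambda>j. (grid T N (j+1), min (w j) (w (j+1)))) ` {1..N-1}
         \<union> (\<lambda>j. (upper_break T N X j, max (w j) (w (j+1)))) ` {1..N-2})"

definition env_upper :: "real \<Rightarrow> nat \<Rightarrow> (real \<Rightarrow> real) set \<Rightarrow> real \<Rightarrow> real" where
  "env_upper T N X = pw_affine (upper_nodes T N X)"

definition lower_break :: "real \<Rightarrow> nat \<Rightarrow> (real \<Rightarrow> real) set \<Rightarrow> nat \<Rightarrow> real" where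
  "lower_break T N X j =
     (let \<delta> = step_lower T N X (grid T N (j+1)) - step_lower T N X (grid T N j)
      in if \<delta> \<ge> 0 then grid T N (j+1) - \<delta> / r_upper T X
         else grid T N (j+1) + \<delta> / r_lower T X)"

definition lower_nodes :: "real \<Rightarrow> nat \<Rightarrow> (real \<Rightarrow> real) set \<Rightarrow> (real \<times> real) set" where
  "lower_nodes T N X =
     (let w = (\<lambda>j. step_lower T N X (grid T N j))
      in {(grid T N 1, w 1)}
         \<union> (\<lambda>j. (grid T N (j+1), max (w j) (w (j+1)))) ` {1..N-1}
         \<union> (\<lambda>j. (lower_break T N X j, min (w j) (w (j+1)))) ` {1..N-2})"

definition env_lower :: "real \<Rightarrow> nat \<Rightarrow> (real \<Rightarrow> real) set \<Rightarrow> real \<Rightarrow> real" where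
  "env_lower T N X = pw_affine (lower_nodes T N X)"

definition breakpoints :: "real \<Rightarrow> nat \<Rightarrow> ('d \<Rightarrow> (real \<Rightarrow> real) set) \<Rightarrow> real set" where
  "breakpoints T N \<Xi> =
     (\<Union>d. fst ` upper_nodes T N (\<Xi> d) \<union> fst ` lower_nodes T N (\<Xi> d))"

text \<open>
  For a finite set \<open>B\<close> of breakpoints, \<open>brk B 1 < \<dots> < brk B (card B)\<close> is its
  increasing enumeration.
\<close>

definition brk :: "real set \<Rightarrow> nat \<Rightarrow> real" where
  "brk B j = sorted_list_of_set B ! (j - 1)"

definition brk_gap :: "real set \<Rightarrow> nat \<Rightarrow> real" where
  "brk_gap B j = brk B (j+1) - brk B j"

definition brk_index :: "real \<Rightarrow> real set \<Rightarrow> real \<Rightarrow> nat" where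
  "brk_index T B t =
     (if t = T then card B - 1
      else (THE j. j \<in> {1..card B - 1} \<and> t \<in> {brk B j..<brk B (j+1)}))"

definition brk_weight :: "real \<Rightarrow> real set \<Rightarrow> real \<Rightarrow> real" where
  "brk_weight T B t =
     (if t = T then 1
      else (t - brk B (brk_index T B t)) / brk_gap B (brk_index T B t))"

definition decision_rule ::
  "real \<Rightarrow> real set \<Rightarrow> real^'d^'g \<Rightarrow> (nat \<Rightarrow> real^'g) \<Rightarrow> (real \<Rightarrow> real^'d) \<Rightarrow> real \<Rightarrow> real^'g"
where
  "decision_rule T B \<alpha> \<beta> \<xi> t =
     \<alpha> *v \<xi> t + (1 - brk_weight T B t) *\<^sub>R \<beta> (brk_index T B t)
       + brk_weight T B t *\<^sub>R \<beta> (brk_index T B t + 1)"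

text \<open>
  The supremum is taken in the extended reals, so that no boundedness is presupposed.
\<close>

definition worst_case_cost ::
  "real \<Rightarrow> real^'g \<Rightarrow> (real \<Rightarrow> real^'d) set \<Rightarrow>
   ((real \<Rightarrow> real^'d) \<Rightarrow> real \<Rightarrow> real^'g) \<Rightarrow> ereal"
where
  "worst_case_cost T C \<Omega> x = (SUP \<xi>\<in>\<Omega>. ereal (integral {0..T} (\<lambda>t. C \<bullet> x \<xi> t)))"

end

theory Submission
  imports Defs
begin

text \<open>
  Along the decision rule the cost splits into one part that depends on \<open>\<beta>\<close> only and, for every
  load \<open>d\<close>, the integral of the \<open>d\<close>-th demand trajectory times the constant
  \<open>c = C \<bullet> column d \<alpha>\<close> (\<open>integral_cost_decision_rule\<close>).  As \<open>\<Omega>\<close> is a product, the loads can be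
  treated separately, and for one load the worst trajectory is the upper envelope if \<open>c \<ge> 0\<close> and
  the lower one otherwise: each lies in \<open>\<Omega>\<^sub>d\<close> and bounds all of \<open>\<Omega>\<^sub>d\<close> pointwise.  So the supremum
  is attained, and it is a maximum of two integrals for each load.

  It remains to integrate the envelopes and the \<open>\<beta>\<close>-part.  All are affine on every gap between
  consecutive breakpoints, so that the trapezoidal rule is exact (\<open>has_integral_trapezoids\<close>).  This
  gives integrals over \<open>{0..T}\<close> only if the breakpoints lie in this interval
  (\<open>breakpoints_subset\<close>).  The reason is that shifting time by one grid cell changes a demand by an
  amount between \<open>h * r_lower\<close> and \<open>h * r_upper\<close>, where \<open>h\<close> is the cell length; hence so do the
  step bounds change, and each additional breakpoint is at most one cell away from the interior grid
  point it belongs to.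

  Different prescriptions of the value of an envelope at one breakpoint do no harm here:
  \<open>pw_affine\<close> then selects some value, and it remains the affine interpolation of the selected
  values.
\<close>

section \<open>Increasing enumeration of a finite set\<close>

lemma brk_mem:
  assumes "finite B" "j \<in> {1..card B}"
  shows "brk B j \<in> B"
  using assms nth_mem[of "j - 1" "sorted_list_of_set B"] by (auto simp: brk_def)

lemma brk_less:
  assumes "finite B" "1 \<le> i" "i < j" "j \<le> card B"
  shows "brk B i < brk B j"
  unfolding brk_def
  using assms strict_sorted_list_of_set[of B]
  by (intro sorted_wrt_nth_less[where P = "(<)"]) auto

lemma brk_le:
  assumes "finite B" "1 \<le> i" "i \<le> j" "j \<le> card B"
  shows "brk B i \<le> brk B j"
  using brk_less[OF assms(1,2), of j] assms by (cases "i = j") auto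

lemma brk_surj:
  assumes "finite B" "b \<in> B"
  obtains j where "j \<in> {1..card B}" "b = brk B j"
proof -
  obtain i where "i < card B" "b = sorted_list_of_set B ! i"
    using assms by (metis in_set_conv_nth length_sorted_list_of_set set_sorted_list_of_set)
  then show ?thesis using that[of "i + 1"] by (auto simp: brk_def)
qed

lemma brk_no_between:
  assumes "finite B" "j \<in> {1..card B - 1}" "b \<in> B"
  shows "b \<le> brk B j \<or> brk B (j+1) \<le> b"
proof -
  obtain i where i: "i \<in> {1..card B}" "b = brk B i"
    using assms brk_surj by blast
  show ?thesis
    using brk_le[OF assms(1), of i j] brk_le[OF assms(1), of "j+1" i] i assms(2)
    by (cases "i \<le> j") auto
qed

lemma brk_first:
  assumes "finite B" "a \<in> B" "\<And>b. b \<in> B \<Longrightarrow> a \<le> b"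
  shows "brk B 1 = a"
proof -
  obtain i where i: "i \<in> {1..card B}" "a = brk B i"
    using assms brk_surj by blast
  show ?thesis
    using assms(3)[OF brk_mem[OF assms(1), of 1]] brk_le[OF assms(1), of 1 i] i by auto
qed

lemma brk_last:
  assumes "finite B" "a \<in> B" "\<And>b. b \<in> B \<Longrightarrow> b \<le> a"
  shows "brk B (card B) = a"
proof -
  obtain i where i: "i \<in> {1..card B}" "a = brk B i"
    using assms brk_surj by blast
  show ?thesis
    using assms(3)[OF brk_mem[OF assms(1), of "card B"]] brk_le[OF assms(1), of i "card B"] i
    by auto
qed

lemma brk_index_eq:
  assumes "finite B" "\<And>b. b \<in> B \<Longrightarrow> b \<le> T" "j \<in> {1..card B - 1}"
    and t: "t \<in> {brk B j..<brk B (j+1)}"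
  shows "brk_index T B t = j"
proof -
  have "j + 1 \<in> {1..card B}" using assms(3) by auto
  then have "t < T" using t assms(2)[OF brk_mem[OF assms(1)]] by fastforce
  moreover have "i = j" if "i \<in> {1..card B - 1}" "t \<in> {brk B i..<brk B (i+1)}" for i
  proof -
    have "i \<le> card B" "j \<le> card B" using that(1) assms(3) by auto
    then show ?thesis
      using brk_le[OF assms(1), of "i+1" j] brk_le[OF assms(1), of "j+1" i] that t assms(3)
      by (cases i j rule: linorder_cases) auto
  qed
  then have "(THE i. i \<in> {1..card B - 1} \<and> t \<in> {brk B i..<brk B (i+1)}) = j"
    using assms(3) t by (intro the_equality) blast+
  ultimately show ?thesis by (simp add: brk_index_def)
qed

section \<open>The trapezoidal rule for piecewise affine functions\<close>

lemma has_integral_affine: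
  fixes x y p q :: real
  assumes "x < y"
  shows "((\<lambda>t. p + (t - x) / (y - x) * (q - p)) has_integral (y - x) * (p + q) / 2) {x..y}"
proof -
  define k where "k = (q - p) / (y - x)"
  let ?F = "\<lambda>t. p * t + (t - x)^2 * (k / 2)"
  have "(?F has_vector_derivative (p + (t - x) * k)) (at t within {x..y})" for t
    unfolding has_real_derivative_iff_has_vector_derivative[symmetric]
    by (auto intro!: derivative_eq_intros)
  then have "((\<lambda>t. p + (t - x) * k) has_integral (?F y - ?F x)) {x..y}"
    using assms by (intro fundamental_theorem_of_calculus) auto
  moreover have "?F y - ?F x = (y - x) * (p + q) / 2"
  proof -
    have "(y - x)^2 * (k / 2) = (y - x) * (k * (y - x)) / 2"
      by (simp add: power2_eq_square)
    also have "k * (y - x) = q - p" using assms by (simp add: k_def)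
    finally show ?thesis by (simp add: field_simps)
  qed
  moreover have "(t - x) * k = (t - x) / (y - x) * (q - p)" for t
    by (simp add: k_def)
  ultimately show ?thesis by (simp only:)
qed

text \<open>
  The gaps are half open because \<open>brk_index\<close> assigns each breakpoint to the gap on its right; one
  point per gap does not affect the integral.
\<close>

lemma has_integral_trapezoids:
  fixes f :: "real \<Rightarrow> real"
  assumes "finite B" "B \<noteq> {}"
    and affine: "\<And>j t. j \<in> {1..card B - 1} \<Longrightarrow> t \<in> {brk B j..<brk B (j+1)} \<Longrightarrow>
      f t = p j + (t - brk B j) / brk_gap B j * (q j - p j)"
  shows "(f has_integral 1/2 * (\<Sum>j=1..card B - 1. brk_gap B j * (p j + q j)))
           {brk B 1..brk B (card B)}"
proof -
  have "(f has_integral (\<Sum>j=1..m. brk_gap B j * (p j + q j) / 2)) {brk B 1..brk B (m+1)}"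
    if "m + 1 \<le> card B" for m
    using that
  proof (induction m)
    case (Suc m)
    let ?x = "brk B (Suc m)" and ?y = "brk B (Suc m + 1)"
    have xy: "?x < ?y" using brk_less[OF assms(1), of "Suc m" "Suc m + 1"] Suc.prems by simp
    have "(f has_integral brk_gap B (Suc m) * (p (Suc m) + q (Suc m)) / 2) {?x..?y}"
      using has_integral_affine[OF xy, of "p (Suc m)" "q (Suc m)"] affine[of "Suc m"] Suc.prems
      unfolding brk_gap_def
      by (elim has_integral_spike_finite[where S = "{?y}", rotated 2]) auto
    then have "(f has_integral ((\<Sum>j=1..m. brk_gap B j * (p j + q j) / 2)
                 + brk_gap B (Suc m) * (p (Suc m) + q (Suc m)) / 2)) {brk B 1..?y}"
      using Suc xy brk_le[OF assms(1), of 1 "Suc m"]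
      by (intro has_integral_combine[where c = ?x]) auto
    then show ?case by simp
  qed (simp add: has_integral_refl)
  from this[of "card B - 1"] show ?thesis
    using assms by (simp add: sum_distrib_left card_gt_0_iff Suc_leI)
qed

text \<open>
  The set of nodes may be coarser than the points \<open>x\<close>, \<open>y\<close> at hand: an envelope has to be treated
  on the breakpoints of all envelopes together.
\<close>

lemma pw_affine_between_nodes:
  assumes "finite P"
    and "\<exists>b\<in>fst ` P. b \<le> x" "\<exists>b\<in>fst ` P. y \<le> b"
    and none: "\<And>b. b \<in> fst ` P \<Longrightarrow> b \<le> x \<or> y \<le> b"
    and "x < y" "t \<in> {x..y}"
  shows "pw_affine P t = pw_affine P x + (t - x) / (y - x) * (pw_affine P y - pw_affine P x)"
proof -
  define S where "S = fst ` P"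
  define v where "v = (\<lambda>b. THE w. (b, w) \<in> P)"
  define a where "a = Max {b \<in> S. b \<le> x}"
  define c where "c = Min {b \<in> S. y \<le> b}"
  have S: "finite S" unfolding S_def using assms(1) by simp
  have "a \<in> {b \<in> S. b \<le> x}" unfolding a_def
    using S assms(2) by (intro Max_in) (auto simp: S_def)
  then have a: "a \<in> S" "a \<le> x" by auto
  have "c \<in> {b \<in> S. y \<le> b}" unfolding c_def
    using S assms(3) by (intro Min_in) (auto simp: S_def)
  then have c: "c \<in> S" "y \<le> c" by auto
  have a_max: "b \<le> a" if "b \<in> S" "b \<le> x" for b
    unfolding a_def using S that by (intro Max_ge) auto
  have c_min: "c \<le> b" if "b \<in> S" "y \<le> b" for b
    unfolding c_def using S that by (intro Min_le) auto
  have none': "b \<le> a \<or> c \<le> b" if "b \<in> S" for b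
    using none[of b] a_max[of b] c_min[of b] that by (auto simp: S_def)
  have pw: "pw_affine P s = v a + (s - a) / (c - a) * (v c - v a)" if s: "s \<in> {x..y}" for s
  proof -
    consider "s = a" | "s = c" | "a < s" "s < c" using s a c by fastforce
    then show ?thesis
    proof cases
      case 1
      \<comment> \<open>At a node both neighbours are the node itself, and the quotient is \<open>0 / 0 = 0\<close>.\<close>
      then have "Max {b \<in> S. b \<le> s} = a" "Min {b \<in> S. s \<le> b} = a"
        using S a by (auto intro!: Max_eqI Min_eqI)
      then show ?thesis using 1 by (simp add: pw_affine_def v_def S_def)
    next
      case 2
      then have "Max {b \<in> S. b \<le> s} = c" "Min {b \<in> S. s \<le> b} = c"
        using S c by (auto intro!: Max_eqI Min_eqI)
      then show ?thesis using 2 a c assms(5) by (simp add: pw_affine_def v_def S_def)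
    next
      case 3
      then have "Max {b \<in> S. b \<le> s} = a" "Min {b \<in> S. s \<le> b} = c"
        using S a c none' by (force intro!: Max_eqI Min_eqI)+
      then show ?thesis by (simp add: pw_affine_def v_def S_def Let_def)
    qed
  qed
  have t: "t \<in> {x..y}" and x: "x \<in> {x..y}" and y: "y \<in> {x..y}" using assms(5,6) by auto
  have nz: "c - a \<noteq> 0" "y - x \<noteq> 0" using a c assms(5) by auto
  have "(t - a) / (c - a) = (x - a) / (c - a) + (t - x) / (y - x) * ((y - a) / (c - a) - (x - a) / (c - a))"
    using nz by (simp add: diff_divide_distrib[symmetric] add_divide_distrib[symmetric])
  moreover have "A + (u + m * (w - u)) * e = A + u * e + m * (A + w * e - (A + u * e))"
    for A u m w e :: real by (simp add: algebra_simps)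
  ultimately show ?thesis unfolding pw[OF t] pw[OF x] pw[OF y] by (simp only:)
qed

lemma has_integral_pw_affine:
  assumes "finite P" "finite B" "fst ` P \<subseteq> B"
    and ends: "brk B 1 \<in> fst ` P" "brk B (card B) \<in> fst ` P"
  shows "(pw_affine P has_integral
           1/2 * (\<Sum>j=1..card B - 1. brk_gap B j * (pw_affine P (brk B (j+1)) + pw_affine P (brk B j))))
           {brk B 1..brk B (card B)}"
proof -
  have ne: "B \<noteq> {}" using assms by auto
  have "pw_affine P t = pw_affine P (brk B j)
      + (t - brk B j) / brk_gap B j * (pw_affine P (brk B (j+1)) - pw_affine P (brk B j))"
    if j: "j \<in> {1..card B - 1}" and t: "t \<in> {brk B j..<brk B (j+1)}" for j t
    unfolding brk_gap_def
  proof (rule pw_affine_between_nodes[OF assms(1)])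
    have "brk B 1 \<le> brk B j" "brk B (j+1) \<le> brk B (card B)"
      using j by (auto intro!: brk_le[OF assms(2)])
    then show "\<exists>b\<in>fst ` P. b \<le> brk B j" "\<exists>b\<in>fst ` P. brk B (j+1) \<le> b"
      using ends by blast+
    show "b \<le> brk B j \<or> brk B (j+1) \<le> b" if "b \<in> fst ` P" for b
      using brk_no_between[OF assms(2) j] that assms(3) by auto
  qed (use t in auto)
  from has_integral_trapezoids[OF assms(2) ne this] show ?thesis by (simp add: add.commute)
qed

section \<open>The breakpoints lie in the time interval\<close>

lemma grid_1 [simp]: "grid T N (Suc 0) = 0"
  by (simp add: grid_def)

lemma grid_last: "2 \<le> N \<Longrightarrow> grid T N N = T"
  by (simp add: grid_def)

lemma grid_shift: "grid T N (j+1) = grid T N j + T / (real N - 1)"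
  by (simp add: grid_def add_divide_distrib[symmetric] algebra_simps)

lemma grid_mono:
  assumes "0 < T" "2 \<le> N" "i \<le> j"
  shows "grid T N i \<le> grid T N j"
  using assms by (auto simp: grid_def intro!: divide_right_mono mult_left_mono)

lemma grid_less:
  assumes "0 < T" "2 \<le> N" "i < j"
  shows "grid T N i < grid T N j"
  using assms by (auto simp: grid_def intro!: divide_strict_right_mono mult_strict_left_mono)

lemma grid_mem:
  assumes "0 < T" "2 \<le> N" "j \<in> {1..N}"
  shows "grid T N j \<in> {0..T}"
  using grid_mono[of T N 1 j] grid_mono[of T N j N] assms by (simp add: grid_last)

lemma grid_index_grid:
  assumes "0 < T" "2 \<le> N" "j \<in> {1..N-1}"
  shows "grid_index T N (grid T N j) = j"
proof -
  have "j < N" using assms(2,3) unfolding atLeastAtMost_iff by linarith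
  then have "grid T N j \<noteq> T"
    using grid_less[of T N j N] assms by (auto simp: grid_last)
  moreover have "i = j" if "i \<in> {1..N-1}" "grid T N j \<in> {grid T N i..<grid T N (i+1)}" for i
    using grid_less[of T N j i] grid_mono[of T N "i+1" j] that assms
    by (cases i j rule: linorder_cases) auto
  ultimately show ?thesis
    using assms grid_less[of T N j "j+1"] by (auto simp: grid_index_def)
qed

lemma cell_values_grid:
  assumes "0 < T" "2 \<le> N" "j \<in> {1..N-1}"
  shows "cell_values T N X (grid T N j) =
           {\<xi> \<tau> | \<xi> \<tau>. \<xi> \<in> X \<and> \<tau> \<in> {grid T N j..grid T N (j+1)}}"
  by (simp add: cell_values_def grid_index_grid[OF assms])

lemma increment_bounds:
  assumes "bdd_above (rates T X)" "bdd_below (rates T X)" "\<xi> \<in> X"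
    and "s \<in> {0..T}" "t \<in> {0..T}" "s < t"
  shows "\<xi> t - \<xi> s \<le> r_upper T X * (t - s)" "r_lower T X * (t - s) \<le> \<xi> t - \<xi> s"
proof -
  have "(s, t) \<in> ordered_pairs T" using assms by (simp add: ordered_pairs_def)
  then have "rate \<xi> s t \<in> rates T X" unfolding rates_def using assms(3) by blast
  then have "rate \<xi> s t \<le> r_upper T X" "r_lower T X \<le> rate \<xi> s t"
    using assms by (auto simp: r_upper_def r_lower_def intro!: cSup_upper cInf_lower)
  then show "\<xi> t - \<xi> s \<le> r_upper T X * (t - s)" "r_lower T X * (t - s) \<le> \<xi> t - \<xi> s"
    using assms(6) by (simp_all add: rate_def field_simps)
qed

lemma cSup_le_shift:
  fixes A B :: "real set"
  assumes "B \<noteq> {}" "bdd_above A" "\<And>y. y \<in> B \<Longrightarrow> \<exists>x\<in>A. y \<le> x + c"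
  shows "Sup B \<le> Sup A + c"
proof (rule cSup_least[OF assms(1)])
  fix y assume "y \<in> B"
  then obtain x where "x \<in> A" "y \<le> x + c" using assms(3) by blast
  then show "y \<le> Sup A + c" using cSup_upper[OF _ assms(2), of x] by linarith
qed

lemma cInf_le_shift:
  fixes A B :: "real set"
  assumes "A \<noteq> {}" "bdd_below B" "\<And>x. x \<in> A \<Longrightarrow> \<exists>y\<in>B. y \<le> x + c"
  shows "Inf B \<le> Inf A + c"
proof -
  have "Inf B - c \<le> Inf A"
  proof (rule cInf_greatest[OF assms(1)])
    fix x assume "x \<in> A"
    then obtain y where "y \<in> B" "y \<le> x + c" using assms(3) by blast
    then show "Inf B - c \<le> x" using cInf_lower[OF _ assms(2), of y] by linarith
  qed
  then show ?thesis by simp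
qed

text \<open>
  Translation by \<open>h\<close> maps the \<open>j\<close>-th cell onto the next one and changes the value of a demand by
  an amount between \<open>r_lower * h\<close> and \<open>r_upper * h\<close>.  The suprema and the infima over the two cells
  inherit these bounds.
\<close>

lemma step_increment_bounds:
  fixes T :: real and N j :: nat and X :: "(real \<Rightarrow> real) set"
  defines "h \<equiv> T / (real N - 1)"
  assumes T: "0 < T" "2 \<le> N" and j: "j \<in> {1..N-2}" and X: "X \<noteq> {}"
    and rates: "bdd_above (rates T X)" "bdd_below (rates T X)"
    and steps: "\<And>t. t \<in> {0..T} \<Longrightarrow> bdd_above (cell_values T N X t)"
      "\<And>t. t \<in> {0..T} \<Longrightarrow> bdd_below (cell_values T N X t)"
  shows "step_upper T N X (grid T N (j+1)) - step_upper T N X (grid T N j)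
           \<in> {r_lower T X * h..r_upper T X * h}" (is ?upper)
    and "step_lower T N X (grid T N (j+1)) - step_lower T N X (grid T N j)
           \<in> {r_lower T X * h..r_upper T X * h}" (is ?lower)
proof -
  let ?A = "cell_values T N X (grid T N j)" and ?B = "cell_values T N X (grid T N (j+1))"
  have h: "0 < h" using T by (simp add: h_def)
  have jN: "j \<in> {1..N-1}" "j + 1 \<in> {1..N-1}" using j by auto
  note A = cell_values_grid[OF T jN(1), of X] and B = cell_values_grid[OF T jN(2), of X]
  have g: "grid T N (j+1) = grid T N j + h" "grid T N (j+1+1) = grid T N (j+1) + h"
    unfolding h_def by (rule grid_shift)+
  have "j \<in> {1..N}" "j+1 \<in> {1..N}" "j+1+1 \<in> {1..N}" using j by auto
  then have mem: "grid T N j \<in> {0..T}" "grid T N (j+1) \<in> {0..T}" "grid T N (j+1+1) \<in> {0..T}"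
    using grid_mem[OF T] by blast+
  have bdd: "bdd_above ?A" "bdd_above ?B" "bdd_below ?A" "bdd_below ?B"
    by (rule steps[OF mem(1)] steps[OF mem(2)])+
  obtain \<xi> where "\<xi> \<in> X" using X by blast
  then have ne: "?A \<noteq> {}" "?B \<noteq> {}"
    unfolding A B using h g by fastforce+
  have incr: "\<xi> (s + h) - \<xi> s \<le> r_upper T X * h" "r_lower T X * h \<le> \<xi> (s + h) - \<xi> s"
    if "\<xi> \<in> X" "s \<in> {grid T N j..grid T N (j+1)}" for \<xi> s
    using increment_bounds[OF rates that(1), of s "s + h"] that(2) mem g h by auto
  have B_A: "\<exists>x\<in>?A. y \<le> x + r_upper T X * h \<and> x \<le> y + - (r_lower T X * h)" if y: "y \<in> ?B" for y
  proof -
    obtain \<xi> \<tau> where *: "y = \<xi> \<tau>" "\<xi> \<in> X" "\<tau> \<in> {grid T N (j+1)..grid T N (j+1+1)}"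
      using y unfolding B by blast
    have "\<tau> - h \<in> {grid T N j..grid T N (j+1)}" using *(3) g by simp
    then have "\<xi> (\<tau> - h) \<in> ?A" unfolding A using *(2) by blast
    then show ?thesis using incr[OF *(2) \<open>\<tau> - h \<in> _\<close>] *
      by (intro bexI[of _ "\<xi> (\<tau> - h)"]) auto
  qed
  have A_B: "\<exists>y\<in>?B. y \<le> x + r_upper T X * h \<and> x \<le> y + - (r_lower T X * h)" if x: "x \<in> ?A" for x
  proof -
    obtain \<xi> \<tau> where *: "x = \<xi> \<tau>" "\<xi> \<in> X" "\<tau> \<in> {grid T N j..grid T N (j+1)}"
      using x unfolding A by blast
    have "\<tau> + h \<in> {grid T N (j+1)..grid T N (j+1+1)}" using *(3) g by simp
    then have "\<xi> (\<tau> + h) \<in> ?B" unfolding B using *(2) by blast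
    then show ?thesis using incr[OF *(2,3)] *
      by (intro bexI[of _ "\<xi> (\<tau> + h)"]) auto
  qed
  have "Sup ?B \<le> Sup ?A + r_upper T X * h" "Sup ?A \<le> Sup ?B + - (r_lower T X * h)"
    using B_A A_B by (intro cSup_le_shift ne bdd; blast)+
  then show ?upper by (simp add: step_upper_def)
  have "Inf ?B \<le> Inf ?A + r_upper T X * h" "Inf ?A \<le> Inf ?B + - (r_lower T X * h)"
    using B_A A_B by (intro cInf_le_shift ne bdd; blast)+
  then show ?lower by (simp add: step_lower_def)
qed

text \<open>
  The bound \<open>\<delta> \<le> r * h\<close> forces \<open>r > 0\<close> unless \<open>\<delta> = 0\<close>, and then the quotient is \<open>0\<close> whatever
  \<open>r\<close> is.  A falling step is covered by passing to \<open>- \<delta>\<close> and \<open>- r\<close>.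
\<close>

lemma divide_rate_mem:
  fixes \<delta> r h :: real
  assumes "0 < h" "0 \<le> \<delta>" "\<delta> \<le> r * h"
  shows "\<delta> / r \<in> {0..h}"
proof (cases "\<delta> = 0")
  case False
  then have "0 < r" using assms by (smt (verit) mult_nonpos_nonneg)
  then show ?thesis using assms by (simp add: field_simps)
qed (use assms in simp)

lemma breaks_mem:
  assumes T: "0 < T" "2 \<le> N" and j: "j \<in> {1..N-2}" and X: "X \<noteq> {}"
    and rates: "bdd_above (rates T X)" "bdd_below (rates T X)"
    and steps: "\<And>t. t \<in> {0..T} \<Longrightarrow> bdd_above (cell_values T N X t)"
      "\<And>t. t \<in> {0..T} \<Longrightarrow> bdd_below (cell_values T N X t)"
  shows "upper_break T N X j \<in> {0..T}" "lower_break T N X j \<in> {0..T}"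
proof -
  define h where "h = T / (real N - 1)"
  have h: "0 < h" using T by (simp add: h_def)
  note bounds = step_increment_bounds[OF T j X rates steps, folded h_def]
  have g: "grid T N (j+1) = grid T N j + h" "grid T N (j+1+1) = grid T N (j+1) + h"
    unfolding h_def by (rule grid_shift)+
  have "j \<in> {1..N}" "j+1+1 \<in> {1..N}" using j by auto
  then have mem: "grid T N j \<in> {0..T}" "grid T N (j+1+1) \<in> {0..T}"
    using grid_mem[OF T] by blast+
  have quot: "0 \<le> \<delta> \<Longrightarrow> \<delta> / r_upper T X \<in> {0..h}" "\<delta> < 0 \<Longrightarrow> \<delta> / r_lower T X \<in> {0..h}"
    if "\<delta> \<in> {r_lower T X * h..r_upper T X * h}" for \<delta>
    using that divide_rate_mem[OF h, of \<delta> "r_upper T X"]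
      divide_rate_mem[OF h, of "-\<delta>" "- r_lower T X"] by auto
  show "upper_break T N X j \<in> {0..T}" "lower_break T N X j \<in> {0..T}"
    unfolding upper_break_def lower_break_def Let_def
    using quot[OF bounds(1)] quot[OF bounds(2)] g mem by (auto split: if_splits)
qed

lemma finite_nodes: "finite (upper_nodes T N X)" "finite (lower_nodes T N X)"
  by (simp_all add: upper_nodes_def lower_nodes_def Let_def)

lemma zero_in_nodes:
  "0 \<in> fst ` upper_nodes T N X" "0 \<in> fst ` lower_nodes T N X"
  by (simp_all add: upper_nodes_def lower_nodes_def Let_def image_Un)

lemma horizon_in_nodes:
  assumes "2 \<le> N"
  shows "T \<in> fst ` upper_nodes T N X" "T \<in> fst ` lower_nodes T N X"
proof -
  have "N - 1 \<in> {1..N-1}" "grid T N (N - 1 + 1) = T" using assms grid_last[of N T] by auto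
  then show "T \<in> fst ` upper_nodes T N X" "T \<in> fst ` lower_nodes T N X"
    unfolding upper_nodes_def lower_nodes_def Let_def image_Un image_image fst_conv
    by (metis (no_types, lifting) UnI1 UnI2 imageI)+
qed

lemma nodes_subset_breakpoints:
  "fst ` upper_nodes T N (\<Xi> d) \<subseteq> breakpoints T N \<Xi>"
  "fst ` lower_nodes T N (\<Xi> d) \<subseteq> breakpoints T N \<Xi>"
  unfolding breakpoints_def by (rule SUP_upper2[of d]; simp)+

lemma breakpoints_subset:
  assumes T: "0 < T" "2 \<le> N" and "\<And>d. \<Xi> d \<noteq> {}"
    and "\<And>d. bdd_above (rates T (\<Xi> d))" "\<And>d. bdd_below (rates T (\<Xi> d))"
    and "\<And>d t. t \<in> {0..T} \<Longrightarrow> bdd_above (cell_values T N (\<Xi> d) t)"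
      "\<And>d t. t \<in> {0..T} \<Longrightarrow> bdd_below (cell_values T N (\<Xi> d) t)"
  shows "breakpoints T N \<Xi> \<subseteq> {0..T}"
proof -
  have 1: "upper_break T N (\<Xi> d) j \<in> {0..T}" "lower_break T N (\<Xi> d) j \<in> {0..T}"
    if "j \<in> {1..N-2}" for d j
    by (rule breaks_mem[OF T that assms(3-7)]; assumption)+
  have 2: "grid T N (j+1) \<in> {0..T}" if "j \<in> {1..N-1}" for j
    using that T by (intro grid_mem) auto
  have "fst ` upper_nodes T N (\<Xi> d) \<subseteq> {0..T}" "fst ` lower_nodes T N (\<Xi> d) \<subseteq> {0..T}" for d
    unfolding upper_nodes_def lower_nodes_def Let_def image_Un image_image fst_conv
    using 1 2 T(1) by (simp_all add: image_subset_iff)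
  then show ?thesis unfolding breakpoints_def by blast
qed

section \<open>The cost of a decision rule\<close>

lemma inner_matrix_vector_mult:
  fixes \<alpha> :: "real^'d^'g" and C :: "real^'g" and x :: "real^'d"
  shows "C \<bullet> (\<alpha> *v x) = (\<Sum>d\<in>UNIV. (C \<bullet> column d \<alpha>) * x $ d)"
  by (simp add: matrix_mult_sum inner_sum_right scalar_mult_eq_scaleR mult.commute)

lemma integral_cost_decision_rule:
  fixes \<alpha> :: "real^'d::finite^'g::finite"
  assumes B: "finite B" "B \<subseteq> {0..T}" "0 \<in> B" "T \<in> B"
    and \<xi>: "\<And>d. (\<lambda>t. \<xi> t $ d) integrable_on {0..T}"
  shows "integral {0..T} (\<lambda>t. C \<bullet> decision_rule T B \<alpha> \<beta> \<xi> t) =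
           1/2 * (\<Sum>j=1..card B - 1. brk_gap B j * (C \<bullet> (\<beta> (j+1) + \<beta> j)))
           + (\<Sum>d\<in>UNIV. (C \<bullet> column d \<alpha>) * integral {0..T} (\<lambda>t. \<xi> t $ d))"
proof -
  define b where "b t = (1 - brk_weight T B t) * (C \<bullet> \<beta> (brk_index T B t))
      + brk_weight T B t * (C \<bullet> \<beta> (brk_index T B t + 1))" for t
  have le: "x \<le> T" "0 \<le> x" if "x \<in> B" for x using B(2) that by auto
  have ends: "brk B 1 = 0" "brk B (card B) = T"
    using brk_first[OF B(1,3)] brk_last[OF B(1,4)] le by blast+
  have "b t = C \<bullet> \<beta> j + (t - brk B j) / brk_gap B j * (C \<bullet> \<beta> (j+1) - C \<bullet> \<beta> j)"
    if j: "j \<in> {1..card B - 1}" and t: "t \<in> {brk B j..<brk B (j+1)}" for j t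
  proof -
    have idx: "brk_index T B t = j" using brk_index_eq[OF B(1) _ j t] le(1) by blast
    have "j + 1 \<in> {1..card B}" using j by auto
    then have "t \<noteq> T" using t le(1)[OF brk_mem[OF B(1)]] by fastforce
    then have "brk_weight T B t = (t - brk B j) / brk_gap B j"
      using idx by (simp add: brk_weight_def)
    then show ?thesis
      by (simp add: b_def idx algebra_simps)
  qed
  from has_integral_trapezoids[OF B(1) _ this] have
    "(b has_integral 1/2 * (\<Sum>j=1..card B - 1. brk_gap B j * (C \<bullet> (\<beta> (j+1) + \<beta> j)))) {0..T}"
    using B(3) by (auto simp: ends[simplified] inner_add_right add.commute)
  moreover have "((\<lambda>t. \<Sum>d\<in>UNIV. (C \<bullet> column d \<alpha>) * \<xi> t $ d) has_integral
      (\<Sum>d\<in>UNIV. (C \<bullet> column d \<alpha>) * integral {0..T} (\<lambda>t. \<xi> t $ d))) {0..T}"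
    using \<xi> by (intro has_integral_sum has_integral_mult_right integrable_integral) auto
  moreover have "C \<bullet> decision_rule T B \<alpha> \<beta> \<xi> t
      = b t + (\<Sum>d\<in>UNIV. (C \<bullet> column d \<alpha>) * \<xi> t $ d)" for t
    by (simp add: decision_rule_def b_def inner_add_right inner_matrix_vector_mult)
  ultimately show ?thesis
    by (simp only:) (intro integral_unique has_integral_add)
qed

theorem proposition1:
  fixes T :: real and N :: nat
    and C :: "real^'g::finite"
    and \<Xi> :: "'d::finite \<Rightarrow> (real \<Rightarrow> real) set"
    and \<alpha> :: "real^'d^'g"
    and \<beta> :: "nat \<Rightarrow> real^'g"
  assumes "0 < T" and "2 \<le> N"
    and C_nonneg: "\<And>g. 0 \<le> C $ g"
    and two_elements: "\<And>d. \<exists>\<xi>\<in>\<Xi> d. \<exists>\<eta>\<in>\<Xi> d. \<exists>t\<in>{0..T}. \<xi> t \<noteq> \<eta> t"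
    and finite_rates: "\<And>d. bdd_above (rates T (\<Xi> d))" "\<And>d. bdd_below (rates T (\<Xi> d))"
    and finite_steps:
      "\<And>d t. t \<in> {0..T} \<Longrightarrow> bdd_above (cell_values T N (\<Xi> d) t)"
      "\<And>d t. t \<in> {0..T} \<Longrightarrow> bdd_below (cell_values T N (\<Xi> d) t)"
    and env_in_Omega:
      "\<And>d. env_upper T N (\<Xi> d) \<in> Omega1 T N (\<Xi> d)"
      "\<And>d. env_lower T N (\<Xi> d) \<in> Omega1 T N (\<Xi> d)"
    and env_extreme:
      "\<And>d \<xi> t. \<xi> \<in> Omega1 T N (\<Xi> d) \<Longrightarrow> t \<in> {0..T} \<Longrightarrow>
         env_lower T N (\<Xi> d) t \<le> \<xi> t \<and> \<xi> t \<le> env_upper T N (\<Xi> d) t"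
    and env_range:
      "\<And>d t. t \<in> {0..T} \<Longrightarrow>
         {\<xi> t | \<xi>. \<xi> \<in> Omega1 T N (\<Xi> d)} = {env_lower T N (\<Xi> d) t..env_upper T N (\<Xi> d) t}"
  shows "let B = breakpoints T N \<Xi>; M = card B;
             s_upper = (\<lambda>d j. env_upper T N (\<Xi> d) (brk B (j+1)) + env_upper T N (\<Xi> d) (brk B j));
             s_lower = (\<lambda>d j. env_lower T N (\<Xi> d) (brk B (j+1)) + env_lower T N (\<Xi> d) (brk B j))
         in worst_case_cost T C (Omega T N \<Xi>) (decision_rule T B \<alpha> \<beta>) =
            ereal (1/2 * (\<Sum>j=1..M-1. brk_gap B j * (C \<bullet> (\<beta> (j+1) + \<beta> j)))
                 + 1/2 * (\<Sum>d\<in>UNIV.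
                     max (\<Sum>j=1..M-1. brk_gap B j * s_upper d j * (C \<bullet> column d \<alpha>))
                         (\<Sum>j=1..M-1. brk_gap B j * s_lower d j * (C \<bullet> column d \<alpha>))))"
proof -
  define B where "B = breakpoints T N \<Xi>"
  define U where "U d = env_upper T N (\<Xi> d)" for d
  define L where "L d = env_lower T N (\<Xi> d)" for d
  define c where "c d = C \<bullet> column d \<alpha>" for d
  define b where "b = 1/2 * (\<Sum>j=1..card B - 1. brk_gap B j * (C \<bullet> (\<beta> (j+1) + \<beta> j)))"
  have ne: "\<Xi> d \<noteq> {}" for d using two_elements[of d] by blast
  have nodes: "fst ` upper_nodes T N (\<Xi> d) \<subseteq> B" "fst ` lower_nodes T N (\<Xi> d) \<subseteq> B" for d
    unfolding B_def by (rule nodes_subset_breakpoints)+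
  have "B \<subseteq> {0..T}"
    unfolding B_def using breakpoints_subset[OF assms(1,2) ne finite_rates finite_steps] .
  moreover have "finite B" by (simp add: B_def breakpoints_def finite_nodes)
  moreover have "0 \<in> B" "T \<in> B"
    using zero_in_nodes(1)[THEN subsetD[OF nodes(1)]]
      horizon_in_nodes(1)[OF assms(2), THEN subsetD[OF nodes(1)]] .
  ultimately have B: "finite B" "B \<subseteq> {0..T}" "0 \<in> B" "T \<in> B" by simp_all
  have "0 \<le> x" "x \<le> T" if "x \<in> B" for x using that B(2) by auto
  then have ends: "brk B 1 = 0" "brk B (card B) = T"
    by (auto intro!: brk_first[OF B(1,3), simplified] brk_last[OF B(1,4)])
  have int_U: "integral {0..T} (U d) =
      1/2 * (\<Sum>j=1..card B - 1. brk_gap B j * (U d (brk B (j+1)) + U d (brk B j)))" for d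
    using has_integral_pw_affine[OF finite_nodes(1) B(1) nodes(1), unfolded ends,
        OF zero_in_nodes(1) horizon_in_nodes(1)[OF assms(2)], of d]
    unfolding U_def env_upper_def by (rule integral_unique)
  have int_L: "integral {0..T} (L d) =
      1/2 * (\<Sum>j=1..card B - 1. brk_gap B j * (L d (brk B (j+1)) + L d (brk B j)))" for d
    using has_integral_pw_affine[OF finite_nodes(2) B(1) nodes(2), unfolded ends,
        OF zero_in_nodes(2) horizon_in_nodes(2)[OF assms(2)], of d]
    unfolding L_def env_lower_def by (rule integral_unique)
  have integrable: "\<xi> integrable_on {0..T}" if "\<xi> \<in> Omega1 T N (\<Xi> d)" for \<xi> d
    using that by (auto simp: Omega1_def intro: integrable_continuous_real)
  have cost: "integral {0..T} (\<lambda>t. C \<bullet> decision_rule T B \<alpha> \<beta> \<xi> t)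
      = b + (\<Sum>d\<in>UNIV. c d * integral {0..T} (\<lambda>t. \<xi> t $ d))" if "\<xi> \<in> Omega T N \<Xi>" for \<xi>
    unfolding b_def c_def using that integrable
    by (intro integral_cost_decision_rule B) (auto simp: Omega_def)
  define V where "V = b + (\<Sum>d\<in>UNIV. max (c d * integral {0..T} (U d)) (c d * integral {0..T} (L d)))"
  \<comment> \<open>Each load takes the envelope that the sign of its coefficient favours; \<open>\<Omega>\<close> being a
    product, this mixture of upper and lower envelopes is admissible.\<close>
  define \<xi>\<^sub>0 where "\<xi>\<^sub>0 t = (\<chi> d. if 0 \<le> c d then U d t else L d t)" for t
  have bounds: "integral {0..T} (L d) \<le> integral {0..T} \<xi>" "integral {0..T} \<xi> \<le> integral {0..T} (U d)"
    if "\<xi> \<in> Omega1 T N (\<Xi> d)" for \<xi> d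
    using integrable[OF that] integrable[OF env_in_Omega(1)] integrable[OF env_in_Omega(2)]
      env_extreme[OF that]
    unfolding U_def L_def by (intro integral_le; blast)+
  have le_U: "integral {0..T} (L d) \<le> integral {0..T} (U d)" for d
    using bounds(1)[OF env_in_Omega(1)] unfolding U_def .
  have max_eq: "max (c d * integral {0..T} (U d)) (c d * integral {0..T} (L d))
      = c d * integral {0..T} (\<lambda>t. \<xi>\<^sub>0 t $ d)" for d
  proof (cases "0 \<le> c d")
    case True
    then show ?thesis using max_absorb1[OF mult_left_mono[OF le_U[of d] True]] by (simp add: \<xi>\<^sub>0_def)
  next
    case False
    then show ?thesis using max_absorb2[OF mult_left_mono_neg[OF le_U[of d]], of "c d"] by (simp add: \<xi>\<^sub>0_def)
  qed
  have \<xi>\<^sub>0: "\<xi>\<^sub>0 \<in> Omega T N \<Xi>"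
  proof -
    have "(\<lambda>t. \<xi>\<^sub>0 t $ d) \<in> Omega1 T N (\<Xi> d)" for d
      using env_in_Omega by (cases "0 \<le> c d") (simp_all add: \<xi>\<^sub>0_def U_def L_def)
    then show ?thesis by (simp add: Omega_def)
  qed
  have "integral {0..T} (\<lambda>t. C \<bullet> decision_rule T B \<alpha> \<beta> \<xi> t) \<le> V" if "\<xi> \<in> Omega T N \<Xi>" for \<xi>
    unfolding cost[OF that] V_def
  proof (intro add_left_mono sum_mono)
    fix d
    have "(\<lambda>t. \<xi> t $ d) \<in> Omega1 T N (\<Xi> d)" using that by (simp add: Omega_def)
    note bounds[OF this]
    then show "c d * integral {0..T} (\<lambda>t. \<xi> t $ d)
        \<le> max (c d * integral {0..T} (U d)) (c d * integral {0..T} (L d))"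
      by (cases "0 \<le> c d") (auto simp: le_max_iff_disj mult_left_mono mult_left_mono_neg)
  qed
  moreover have "integral {0..T} (\<lambda>t. C \<bullet> decision_rule T B \<alpha> \<beta> \<xi>\<^sub>0 t) = V"
    unfolding cost[OF \<xi>\<^sub>0] V_def max_eq ..
  ultimately have "worst_case_cost T C (Omega T N \<Xi>) (decision_rule T B \<alpha> \<beta>) = ereal V"
    unfolding worst_case_cost_def using \<xi>\<^sub>0 by (intro SUP_eqI) auto
  moreover have "max (c d * integral {0..T} (U d)) (c d * integral {0..T} (L d)) =
      1/2 * max (\<Sum>j=1..card B - 1. brk_gap B j * (U d (brk B (j+1)) + U d (brk B j)) * c d)
                (\<Sum>j=1..card B - 1. brk_gap B j * (L d (brk B (j+1)) + L d (brk B j)) * c d)" for d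
    unfolding int_U int_L sum_distrib_right[symmetric] by (simp add: max_def mult.commute)
  ultimately show ?thesis
    by (simp only: V_def sum_distrib_left[symmetric] Let_def b_def B_def U_def L_def c_def)
qed

end
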